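(* Let $\alpha$ be a regular curve in $\mathbb{E}^3$ parametrized by arc-length, with curvature function $\kappa=\Vert\alpha''\Vert$. The scalar angular velocity $w$ of any adapted orthonormal moving frame $\{\mathbf e_0,\mathbf e_1,\mathbf e_2\}$ along $\alpha$, whose equations of motion are $$\mathbf e_0'=\chi_2\mathbf e_1-\chi_1\mathbf e_2,\quad \mathbf e_1'=-\chi_2\mathbf e_0+\omega\mathbf e_2,\quad \mathbf e_2'=\chi_1\mathbf e_0-\omega\mathbf e_1,$$ satisfies $$w=\sqrt{\omega^2+\chi_1^2+\chi_2^2}\ \geq\ \kappa .$$
   Context: $\mathbb{E}^3$ is $\mathbb{R}^3$ with the standard inner product. A moving frame $\{\mathbf e_0,\mathbf e_1,\mathbf e_2\}$ along $\alpha$ is adapted if it is orthonormal, (positively oriented) and $\mathbf e_0=\mathbf t=\alpha'$. With the Darboux vector $\mathbf w=\omega\mathbf e_0+\chi_1\mathbf e_1+\chi_2\mathbf e_2$ the equations of motion read $\mathbf e_i'=\mathbf w\times\mathbf e_i$, and the scalar angular velocity is $w=\Vert\mathbf w\Vert=\sqrt{\omega^2+\chi_1^2+\chi_2^2}$. *)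

theory Defs
  imports "HOL-Analysis.Analysis"
begin

definition velocity :: "real set \<Rightarrow> (real \<Rightarrow> real ^ 3) \<Rightarrow> real \<Rightarrow> real ^ 3" where
  "velocity I \<alpha> s = vector_derivative \<alpha> (at s within I)"

definition acceleration :: "real set \<Rightarrow> (real \<Rightarrow> real ^ 3) \<Rightarrow> real \<Rightarrow> real ^ 3" where
  "acceleration I \<alpha> s = vector_derivative (velocity I \<alpha>) (at s within I)"

text \<open>
  The parameter domain is any nondegenerate interval, open or not; derivatives at an endpoint
  belonging to it are one-sided.  Curves are of class \<open>C\<^sup>2\<close>, the least smoothness
  for which the curvature is a continuous function.
\<close>

definition regular_curve :: "real set \<Rightarrow> (real \<Rightarrow> real ^ 3) \<Rightarrow> bool" where
  "regular_curve I \<alpha> \<longleftrightarrow>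
     is_interval I \<and> interior I \<noteq> {} \<and>
     \<alpha> differentiable_on I \<and> velocity I \<alpha> differentiable_on I \<and>
     continuous_on I (acceleration I \<alpha>) \<and>
     (\<forall>s\<in>I. velocity I \<alpha> s \<noteq> 0)"

definition arc_length_parametrized :: "real set \<Rightarrow> (real \<Rightarrow> real ^ 3) \<Rightarrow> bool" where
  "arc_length_parametrized I \<alpha> \<longleftrightarrow> (\<forall>s\<in>I. norm (velocity I \<alpha> s) = 1)"

text \<open>This is the curvature only for curves parametrized by arc length.\<close>

definition curvature :: "real set \<Rightarrow> (real \<Rightarrow> real ^ 3) \<Rightarrow> real \<Rightarrow> real" where
  "curvature I \<alpha> s = norm (acceleration I \<alpha> s)"

definition orthonormal_triple :: "real ^ 3 \<Rightarrow> real ^ 3 \<Rightarrow> real ^ 3 \<Rightarrow> bool" where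
  "orthonormal_triple u v w \<longleftrightarrow>
     norm u = 1 \<and> norm v = 1 \<and> norm w = 1 \<and> u \<bullet> v = 0 \<and> u \<bullet> w = 0 \<and> v \<bullet> w = 0"

definition positively_oriented :: "real ^ 3 \<Rightarrow> real ^ 3 \<Rightarrow> real ^ 3 \<Rightarrow> bool" where
  "positively_oriented u v w \<longleftrightarrow> det (vector [u, v, w] :: real ^ 3 ^ 3) > 0"

definition adapted_frame ::
  "real set \<Rightarrow> (real \<Rightarrow> real ^ 3) \<Rightarrow> (real \<Rightarrow> real ^ 3) \<Rightarrow> (real \<Rightarrow> real ^ 3) \<Rightarrow> (real \<Rightarrow> real ^ 3) \<Rightarrow> bool"
where
  "adapted_frame I \<alpha> e\<^sub>0 e\<^sub>1 e\<^sub>2 \<longleftrightarrow>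
     e\<^sub>0 differentiable_on I \<and> e\<^sub>1 differentiable_on I \<and> e\<^sub>2 differentiable_on I \<and>
     (\<forall>s\<in>I. orthonormal_triple (e\<^sub>0 s) (e\<^sub>1 s) (e\<^sub>2 s) \<and>
            positively_oriented (e\<^sub>0 s) (e\<^sub>1 s) (e\<^sub>2 s) \<and>
            e\<^sub>0 s = velocity I \<alpha> s)"

text \<open>
  In the following two definitions the frame comes first and then the coefficients
  \<open>\<omega>\<close>, \<open>\<chi>\<^sub>1\<close>, \<open>\<chi>\<^sub>2\<close> of the Darboux vector in that frame.
\<close>

definition darboux_vector ::
  "(real \<Rightarrow> real ^ 3) \<Rightarrow> (real \<Rightarrow> real ^ 3) \<Rightarrow> (real \<Rightarrow> real ^ 3) \<Rightarrow>
   (real \<Rightarrow> real) \<Rightarrow> (real \<Rightarrow> real) \<Rightarrow> (real \<Rightarrow> real) \<Rightarrow> real \<Rightarrow> real ^ 3"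
where
  "darboux_vector e\<^sub>0 e\<^sub>1 e\<^sub>2 \<omega> \<chi>\<^sub>1 \<chi>\<^sub>2 s =
     \<omega> s *\<^sub>R e\<^sub>0 s + \<chi>\<^sub>1 s *\<^sub>R e\<^sub>1 s + \<chi>\<^sub>2 s *\<^sub>R e\<^sub>2 s"

definition scalar_angular_velocity ::
  "(real \<Rightarrow> real ^ 3) \<Rightarrow> (real \<Rightarrow> real ^ 3) \<Rightarrow> (real \<Rightarrow> real ^ 3) \<Rightarrow>
   (real \<Rightarrow> real) \<Rightarrow> (real \<Rightarrow> real) \<Rightarrow> (real \<Rightarrow> real) \<Rightarrow> real \<Rightarrow> real"
where
  "scalar_angular_velocity e\<^sub>0 e\<^sub>1 e\<^sub>2 \<omega> \<chi>\<^sub>1 \<chi>\<^sub>2 s =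
     norm (darboux_vector e\<^sub>0 e\<^sub>1 e\<^sub>2 \<omega> \<chi>\<^sub>1 \<chi>\<^sub>2 s)"

end

theory Submission
  imports Defs
begin

text \<open>
  An adapted frame has \<open>e\<^sub>0 = \<alpha>'\<close>, so the first equation of motion is a formula for
  the acceleration: \<open>\<alpha>'' = \<chi>\<^sub>2 e\<^sub>1 - \<chi>\<^sub>1 e\<^sub>2\<close>.  By orthonormality of the
  frame, Pythagoras gives \<open>\<kappa>\<^sup>2 = \<chi>\<^sub>1\<^sup>2 + \<chi>\<^sub>2\<^sup>2\<close>, whereas the
  squared length of the Darboux vector has the additional summand \<open>\<omega>\<^sup>2\<close>, the
  rotation about the tangent, which the curve does not see.  Hence
  \<open>w\<^sup>2 = \<omega>\<^sup>2 + \<kappa>\<^sup>2 \<ge> \<kappa>\<^sup>2\<close>.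

  Passing from the equation of motion to the acceleration relies on derivatives within the
  parameter interval being unique.  This holds because the interval is nondegenerate, so that
  each of its points is a limit point, endpoints included
  (\<open>islimpt_interval_interior_nonempty\<close>).
\<close>

lemma norm_orthonormal_combination:
  assumes "orthonormal_triple u v w"
  shows "norm (a *\<^sub>R u + b *\<^sub>R v + c *\<^sub>R w) = sqrt (a\<^sup>2 + b\<^sup>2 + c\<^sup>2)"
proof -
  have "u \<bullet> u = 1" "v \<bullet> v = 1" "w \<bullet> w = 1" "u \<bullet> v = 0" "u \<bullet> w = 0" "v \<bullet> w = 0"
    using assms by (auto simp: orthonormal_triple_def norm_eq_1)
  then show ?thesis
    by (simp add: norm_eq_sqrt_inner inner_add_left inner_add_right inner_commute
        power2_eq_square)
qed

text \<open>
  A singleton has empty interior, and a connected set with more than one point has no isolated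
  points.
\<close>

lemma islimpt_interval_interior_nonempty:
  fixes I :: "real set"
  assumes "is_interval I" and "interior I \<noteq> {}" and "s \<in> I"
  shows "s islimpt I"
proof -
  have "connected I"
    using assms(1) by (rule is_interval_connected)
  moreover have "\<nexists>x. I = {x}"
    using assms(2) by auto
  ultimately show ?thesis
    using assms(3) connected_imp_perfect by blast
qed

text \<open>
  The velocity and \<open>e\<^sub>0\<close> agree on the parameter interval, so they have the same
  derivatives within it; as its points are limit points, such a derivative is unique and is
  therefore the acceleration.
\<close>

lemma acceleration_adapted_frame:
  assumes curve: "regular_curve I \<alpha>"
    and frame: "adapted_frame I \<alpha> e\<^sub>0 e\<^sub>1 e\<^sub>2"
    and s: "s \<in> I"
    and deriv: "(e\<^sub>0 has_vector_derivative d) (at s within I)"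
  shows "acceleration I \<alpha> s = d"
proof -
  have "s islimpt I"
    using curve s by (auto simp: regular_curve_def intro: islimpt_interval_interior_nonempty)
  then have nontrivial: "at s within I \<noteq> bot"
    by (simp add: trivial_limit_within)
  have "(velocity I \<alpha> has_vector_derivative d) (at s within I)"
    using s frame by (auto intro: has_vector_derivative_transform [OF _ _ deriv]
        simp: adapted_frame_def)
  then show ?thesis
    unfolding acceleration_def by (rule vector_derivative_within [OF nontrivial])
qed

theorem proposition3p1p1:
  fixes I :: "real set"
    and \<alpha> e\<^sub>0 e\<^sub>1 e\<^sub>2 :: "real \<Rightarrow> real ^ 3"
    and \<omega> \<chi>\<^sub>1 \<chi>\<^sub>2 :: "real \<Rightarrow> real"
  assumes "regular_curve I \<alpha>"
    and "arc_length_parametrized I \<alpha>"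
    and "adapted_frame I \<alpha> e\<^sub>0 e\<^sub>1 e\<^sub>2"
    and "\<And>s. s \<in> I \<Longrightarrow>
           (e\<^sub>0 has_vector_derivative (\<chi>\<^sub>2 s *\<^sub>R e\<^sub>1 s - \<chi>\<^sub>1 s *\<^sub>R e\<^sub>2 s)) (at s within I)"
    and "\<And>s. s \<in> I \<Longrightarrow>
           (e\<^sub>1 has_vector_derivative (- \<chi>\<^sub>2 s *\<^sub>R e\<^sub>0 s + \<omega> s *\<^sub>R e\<^sub>2 s)) (at s within I)"
    and "\<And>s. s \<in> I \<Longrightarrow>
           (e\<^sub>2 has_vector_derivative (\<chi>\<^sub>1 s *\<^sub>R e\<^sub>0 s - \<omega> s *\<^sub>R e\<^sub>1 s)) (at s within I)"
  shows "\<forall>s\<in>I.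
           scalar_angular_velocity e\<^sub>0 e\<^sub>1 e\<^sub>2 \<omega> \<chi>\<^sub>1 \<chi>\<^sub>2 s = sqrt ((\<omega> s)\<^sup>2 + (\<chi>\<^sub>1 s)\<^sup>2 + (\<chi>\<^sub>2 s)\<^sup>2) \<and>
           sqrt ((\<omega> s)\<^sup>2 + (\<chi>\<^sub>1 s)\<^sup>2 + (\<chi>\<^sub>2 s)\<^sup>2) \<ge> curvature I \<alpha> s"
proof (intro ballI conjI)
  fix s assume s: "s \<in> I"
  have ortho: "orthonormal_triple (e\<^sub>0 s) (e\<^sub>1 s) (e\<^sub>2 s)"
    using assms(3) s unfolding adapted_frame_def by blast
  show "scalar_angular_velocity e\<^sub>0 e\<^sub>1 e\<^sub>2 \<omega> \<chi>\<^sub>1 \<chi>\<^sub>2 s = sqrt ((\<omega> s)\<^sup>2 + (\<chi>\<^sub>1 s)\<^sup>2 + (\<chi>\<^sub>2 s)\<^sup>2)"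
    unfolding scalar_angular_velocity_def darboux_vector_def
    by (rule norm_orthonormal_combination [OF ortho])
  have "curvature I \<alpha> s = norm (\<chi>\<^sub>2 s *\<^sub>R e\<^sub>1 s - \<chi>\<^sub>1 s *\<^sub>R e\<^sub>2 s)"
    using acceleration_adapted_frame [OF assms(1,3) s assms(4) [OF s]]
    by (simp add: curvature_def)
  also have "\<dots> = norm (0 *\<^sub>R e\<^sub>0 s + \<chi>\<^sub>2 s *\<^sub>R e\<^sub>1 s + (- \<chi>\<^sub>1 s) *\<^sub>R e\<^sub>2 s)"
    by simp
  also have "\<dots> = sqrt ((\<chi>\<^sub>1 s)\<^sup>2 + (\<chi>\<^sub>2 s)\<^sup>2)"
    by (subst norm_orthonormal_combination [OF ortho]) (simp add: add.commute)
  also have "\<dots> \<le> sqrt ((\<omega> s)\<^sup>2 + (\<chi>\<^sub>1 s)\<^sup>2 + (\<chi>\<^sub>2 s)\<^sup>2)"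
    by simp
  finally show "curvature I \<alpha> s \<le> sqrt ((\<omega> s)\<^sup>2 + (\<chi>\<^sub>1 s)\<^sup>2 + (\<chi>\<^sub>2 s)\<^sup>2)" .
qed

end
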